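(* Let $\rho$ be a positive integer. Then $$\zeta(3)=\frac{7\rho+12}{6\rho+10}+\sum_{n\ge1}\frac{\Phi_n^{(\rho)}}{2n^4(n+1)^4\,\Theta_n^{(\rho)}\,\Theta_{n+1}^{(\rho)}},$$ where $$\Theta_n^{(\rho)}=\frac{\rho n+1}{n}\;{}_5F_4\!\left(\begin{matrix}n+1,\;n,\;-n,\;-n,\;\rho n+2\\ 1,\;1,\;1,\;\rho n+1\end{matrix}\;\middle|\;1\right)$$ and $$\Phi_n^{(\rho)}=24n^5\rho^2-12n^5+54n^4\rho^2+39n^4\rho-33n^4+46n^3\rho^2+70n^3\rho+19n^2\rho^2+56n^2\rho+33n^2+3n\rho^2+21n\rho+24n+3\rho+5.$$
   Context: $(a)_k=\prod_{j=0}^{k-1}(a+j)$, $(a)_0=1$. The generalized hypergeometric series is ${}_rF_s\!\left(\begin{matrix}a_1,\dots,a_r\\ b_1,\dots,b_s\end{matrix}\middle| z\right)=\sum_{k\ge0}\frac{(a_1)_k\cdots(a_r)_k}{(b_1)_k\cdots(b_s)_k}\frac{z^k}{k!}$ (here it terminates since $(-n)_k=0$ for $k>n$). $\zeta(3)=\sum_{m\ge1}m^{-3}$. *)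

theory Defs
  imports "HOL-Analysis.Analysis"
begin

definition hypergeom :: "'a::real_normed_field list \<Rightarrow> 'a list \<Rightarrow> 'a \<Rightarrow> 'a" where
  "hypergeom as bs z =
     (\<Sum>k. prod_list (map (\<lambda>a. pochhammer a k) as) / prod_list (map (\<lambda>b. pochhammer b k) bs)
            * (z ^ k / fact k))"

definition zeta3 :: real where
  "zeta3 = (\<Sum>m. 1 / real (Suc m) ^ 3)"

definition Theta :: "nat \<Rightarrow> nat \<Rightarrow> real" where
  "Theta \<rho> n = (real \<rho> * real n + 1) / real n *
     hypergeom [real n + 1, real n, - real n, - real n, real \<rho> * real n + 2]
               [1, 1, 1, real \<rho> * real n + 1] 1"

definition Phi :: "nat \<Rightarrow> nat \<Rightarrow> real" where
  "Phi \<rho> n = (let r = real \<rho>; x = real n in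
     24 * x^5 * r^2 - 12 * x^5 + 54 * x^4 * r^2 + 39 * x^4 * r - 33 * x^4
     + 46 * x^3 * r^2 + 70 * x^3 * r + 19 * x^2 * r^2 + 56 * x^2 * r + 33 * x^2
     + 3 * x * r^2 + 21 * x * r + 24 * x + 3 * r + 5)"

definition zeta3_term :: "nat \<Rightarrow> nat \<Rightarrow> real" where
  "zeta3_term \<rho> n =
     Phi \<rho> n / (2 * real n ^ 4 * (real n + 1) ^ 4 * Theta \<rho> n * Theta \<rho> (n + 1))"

end

theory Submission
  imports Defs
begin

text \<open>
  After cancelling the Pochhammer symbols,
  \<open>\<Theta>\<^sub>n = \<Sum>\<^sub>k c\<^sub>n\<^sub>k (\<rho>n + 1 + k) / (n + k)\<close> with the summands \<open>c\<^sub>n\<^sub>k = (n choose k)\<^sup>2 (n + k choose k)\<^sup>2\<close>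
  of the Apery numbers \<open>a\<^sub>n\<close>. Creative telescoping gives
  \<open>\<Sum>\<^sub>k c\<^sub>n\<^sub>k / (n + k) = (7 a\<^sub>n + a\<^sub>n\<^sub>-\<^sub>1) / (12 n)\<close>, so \<open>\<Theta>\<^sub>n\<close> is a combination of \<open>a\<^sub>n\<close> and \<open>a\<^sub>n\<^sub>-\<^sub>1\<close>
  with nonnegative coefficients. Let \<open>B\<^sub>n\<close> be the same combination of the numerators \<open>b\<^sub>n\<close> of
  Apery's approximations to \<open>\<zeta>(3)\<close>. Then \<open>B\<^sub>n / \<Theta>\<^sub>n\<close> lies between \<open>b\<^sub>n / a\<^sub>n\<close> and \<open>b\<^sub>n\<^sub>-\<^sub>1 / a\<^sub>n\<^sub>-\<^sub>1\<close>
  and hence tends to \<open>\<zeta>(3)\<close>. Apery's recurrence, satisfied by both \<open>a\<close> and \<open>b\<close>, yields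
  \<open>a\<^sub>n\<^sub>-\<^sub>1 b\<^sub>n - a\<^sub>n b\<^sub>n\<^sub>-\<^sub>1 = 6 / n\<^sup>3\<close>, which makes
  \<open>B\<^sub>n\<^sub>+\<^sub>1 / \<Theta>\<^sub>n\<^sub>+\<^sub>1 - B\<^sub>n / \<Theta>\<^sub>n\<close> equal to the summand of the theorem, and the series telescopes.
\<close>

section \<open>Apery's sequences and the contiguity relations of their summands\<close>

definition apery_base :: "nat \<Rightarrow> nat \<Rightarrow> real" where
  "apery_base n k = real ((n choose k) * ((n + k) choose k))"

definition apery_a :: "nat \<Rightarrow> real" where
  "apery_a n = (\<Sum>k\<le>n. apery_base n k ^ 2)"

text \<open>Apery's double sequence approximating \<open>zeta3\<close>. Both indices are shifted to
  start at 0, hence \<open>(-1) ^ m\<close> instead of the usual \<open>(-1) ^ (m - 1)\<close>. For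
  \<open>k > n\<close> the extra terms have denominator 0 and therefore value 0.\<close>

definition apery_u :: "nat \<Rightarrow> nat \<Rightarrow> real" where
  "apery_u n k = (\<Sum>m<n. 1 / real (Suc m) ^ 3) +
     (\<Sum>m<k. (-1) ^ m / (2 * real (Suc m) ^ 3 * apery_base n (Suc m)))"

definition apery_b :: "nat \<Rightarrow> real" where
  "apery_b n = (\<Sum>k\<le>n. apery_base n k ^ 2 * apery_u n k)"

text \<open>The middle coefficient of Apery's recurrence, usually written
  \<open>(2 * x + 1) * (17 * x^2 + 17 * x + 5)\<close>.\<close>

definition apery_poly :: "real \<Rightarrow> real" where
  "apery_poly x = 34 * x^3 + 51 * x^2 + 27 * x + 5"

lemma apery_base_0 [simp]: "apery_base n 0 = 1"
  by (simp add: apery_base_def)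

lemma apery_base_eq_0 [simp]: "n < k \<Longrightarrow> apery_base n k = 0"
  by (simp add: apery_base_def)

lemma apery_base_pos: "k \<le> n \<Longrightarrow> apery_base n k > 0"
  by (simp add: apery_base_def)

lemma apery_base_Suc_right:
  "real (Suc k) ^ 2 * apery_base n (Suc k) = (real n - real k) * (real n + real k + 1) * apery_base n k"
proof (cases "k \<le> n")
  case True
  have 1: "real (Suc k) * real (n choose Suc k) = (real n - real k) * real (n choose k)"
  proof -
    have "Suc k * (n choose Suc k) = (n - k) * (n choose k)"
      by (simp only: binomial_absorption binomial_absorb_comp)
    from arg_cong[OF this, of real] show ?thesis using True by (simp only: of_nat_mult of_nat_diff)
  qed
  have 2: "real (Suc k) * real ((n + Suc k) choose Suc k) = (real n + real k + 1) * real ((n + k) choose k)"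
  proof -
    have "Suc k * ((n + Suc k) choose Suc k) = Suc (n + k) * ((n + k) choose k)"
      using Suc_times_binomial[of k "n + k"] by simp
    from arg_cong[OF this, of real] show ?thesis unfolding of_nat_mult by simp
  qed
  have "real (Suc k) ^ 2 * apery_base n (Suc k) =
     (real (Suc k) * real (n choose Suc k)) * (real (Suc k) * real ((n + Suc k) choose Suc k))"
    by (simp add: apery_base_def power2_eq_square)
  thus ?thesis unfolding 1 2 by (simp add: apery_base_def)
qed auto

text \<open>Induction on \<open>k\<close> through \<open>apery_base_Suc_right\<close> at both
  \<open>n\<close> and \<open>n + 1\<close>. The relation is kept free of division because at
  \<open>k = n + 1\<close> the left factor vanishes while \<open>apery_base (Suc n) k\<close> does
  not.\<close>

lemma apery_base_Suc_left:
  "(real n + 1 - real k) * apery_base (Suc n) k = (real n + 1 + real k) * apery_base n k"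
proof (induction k)
  case (Suc k)
  have 1: "real (Suc k) ^ 2 * apery_base n (Suc k) = (real n - real k) * (real n + real k + 1) * apery_base n k"
    and 2: "real (Suc k) ^ 2 * apery_base (Suc n) (Suc k) = (real n + 1 - real k) * (real n + real k + 2) * apery_base (Suc n) k"
    using apery_base_Suc_right[of k n] apery_base_Suc_right[of k "Suc n"] by (auto simp: algebra_simps)
  have "real (Suc k) ^ 2 * ((real n + 1 - real (Suc k)) * apery_base (Suc n) (Suc k)) =
     (real n - real k) * (real (Suc k) ^ 2 * apery_base (Suc n) (Suc k))" by simp
  also have "\<dots> = (real n - real k) * (real n + real k + 2) * ((real n + 1 - real k) * apery_base (Suc n) k)"
    unfolding 2 by simp
  also have "\<dots> = (real n + real k + 2) * ((real n - real k) * (real n + real k + 1) * apery_base n k)"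
    unfolding Suc by simp
  also have "\<dots> = real (Suc k) ^ 2 * ((real n + 1 + real (Suc k)) * apery_base n (Suc k))"
    unfolding 1[symmetric] by simp
  finally show ?case by simp
qed simp

lemma apery_base_prev:
  assumes "n > 0"
  shows "apery_base (n - 1) k = apery_base n k * (real n - real k) / (real n + real k)"
  using apery_base_Suc_left[of "n - 1" k] assms by (simp add: field_simps of_nat_diff)

text \<open>Moving up to \<open>k + 1\<close> leaves only the denominator \<open>(k + 1)^2\<close>,
  which never vanishes. Once all neighbours are multiples of one \<open>apery_base n k\<close>, the
  telescoping relations become identities of rational functions.\<close>

lemma apery_base_step:
  fixes n k :: nat
  defines "x \<equiv> real n" and "y \<equiv> real k" and "d \<equiv> apery_base n k"
  shows "apery_base n (Suc k) = d * (x - y) * (x + y + 1) / (y + 1) ^ 2"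
    and "apery_base (Suc n) (Suc k) = d * (x + y + 1) * (x + y + 2) / (y + 1) ^ 2"
    and "n > 0 \<Longrightarrow> apery_base (n - 1) (Suc k) = d * (x - y) * (x - y - 1) / (y + 1) ^ 2"
proof -
  have y: "y + 1 > 0" by (simp add: y_def)
  show 1: "apery_base n (Suc k) = d * (x - y) * (x + y + 1) / (y + 1) ^ 2"
    using apery_base_Suc_right[of k n] y unfolding x_def y_def d_def by (simp add: eq_divide_eq mult_ac add_ac)
  have "(y + 1) ^ 2 * apery_base (Suc n) (Suc k) = (x + y + 2) * ((x + 1 - y) * apery_base (Suc n) k)"
    using apery_base_Suc_right[of k "Suc n"] unfolding x_def y_def by (simp add: mult_ac add_ac)
  also have "(x + 1 - y) * apery_base (Suc n) k = (x + 1 + y) * d"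
    using apery_base_Suc_left[of n k] unfolding x_def y_def d_def .
  finally show "apery_base (Suc n) (Suc k) = d * (x + y + 1) * (x + y + 2) / (y + 1) ^ 2"
    using y by (simp add: eq_divide_eq mult_ac add_ac)
  assume "n > 0"
  have "x + y + 1 > 0" by (simp add: x_def y_def)
  moreover have "apery_base (n - 1) (Suc k) = apery_base n (Suc k) * (x - y - 1) / (x + y + 1)"
    unfolding apery_base_prev[OF \<open>n > 0\<close>] by (simp add: x_def y_def algebra_simps)
  ultimately show "apery_base (n - 1) (Suc k) = d * (x - y) * (x - y - 1) / (y + 1) ^ 2"
    unfolding 1 by simp
qed

section \<open>Apery's recurrence for the denominators\<close>

text \<open>The Zeilberger--Cohen certificate for the recurrence of the Apery numbers.\<close>

definition apery_cert :: "nat \<Rightarrow> nat \<Rightarrow> real" where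
  "apery_cert n k = 4 * (2 * real n + 1) * (real k * (2 * real k + 1) - (2 * real n + 1) ^ 2) * apery_base n k ^ 2"

text \<open>Both sides are \<open>- 4 * (2 * n + 1)^3\<close>; this anchors the telescoping at
  \<open>k = 0\<close>.\<close>

lemma apery_cert_0:
  "real (Suc n) ^ 3 - apery_poly n + real n ^ 3 = apery_cert n 0"
  by (simp add: apery_cert_def apery_poly_def power2_eq_square power3_eq_cube algebra_simps)

lemma apery_cert_Suc:
  assumes "n > 0"
  shows "real (Suc n) ^ 3 * apery_base (Suc n) (Suc k) ^ 2 - apery_poly n * apery_base n (Suc k) ^ 2
      + real n ^ 3 * apery_base (n - 1) (Suc k) ^ 2 = apery_cert n (Suc k) - apery_cert n k"
proof -
  \<comment> \<open>Dividing by \<open>(k + 1)^2\<close> makes all four values polynomial multiples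
    of \<open>t\<close>, so the claim is a polynomial identity.\<close>
  define x y t where "x = real n" and "y = real k" and "t = apery_base n k / (real k + 1) ^ 2"
  have d: "apery_base n k = t * (y + 1) ^ 2" by (simp add: t_def y_def)
  have dn: "apery_base n (Suc k) = t * ((x - y) * (x + y + 1))"
    and dp: "apery_base (Suc n) (Suc k) = t * ((x + y + 1) * (x + y + 2))"
    and dm: "apery_base (n - 1) (Suc k) = t * ((x - y) * (x - y - 1))"
    unfolding apery_base_step(1,2)[of n k] apery_base_step(3)[OF assms] by (simp_all add: t_def x_def y_def)
  have "(x + 1) ^ 3 * (t * ((x + y + 1) * (x + y + 2))) ^ 2 - apery_poly x * (t * ((x - y) * (x + y + 1))) ^ 2
     + x ^ 3 * (t * ((x - y) * (x - y - 1))) ^ 2 =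
     4 * (2 * x + 1) * ((y + 1) * (2 * (y + 1) + 1) - (2 * x + 1) ^ 2) * (t * ((x - y) * (x + y + 1))) ^ 2
     - 4 * (2 * x + 1) * (y * (2 * y + 1) - (2 * x + 1) ^ 2) * (t * (y + 1) ^ 2) ^ 2"
    unfolding apery_poly_def by algebra
  thus ?thesis unfolding apery_cert_def d dn dp dm by (simp add: x_def y_def add.commute[of 1])
qed

lemma sum_atMost_extend:
  fixes g :: "nat \<Rightarrow> real"
  assumes "m \<le> n" "\<And>k. k > m \<Longrightarrow> g k = 0"
  shows "(\<Sum>k\<le>n. g k) = (\<Sum>k\<le>m. g k)"
  using assms by (intro sum.mono_neutral_right) auto

lemma apery_a_recurrence:
  assumes "n > 0"
  shows "real (Suc n) ^ 3 * apery_a (Suc n) = apery_poly n * apery_a n - real n ^ 3 * apery_a (n - 1)"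
proof -
  define T where "T k = real (Suc n) ^ 3 * apery_base (Suc n) k ^ 2 - apery_poly n * apery_base n k ^ 2
      + real n ^ 3 * apery_base (n - 1) k ^ 2" for k
  have "(\<Sum>k\<le>m. T k) = apery_cert n m" for m
    by (induction m) (simp_all add: T_def apery_cert_Suc[OF assms] apery_cert_0 del: of_nat_Suc One_nat_def)
  \<comment> \<open>The certificate at \<open>n + 1\<close> contains the factor
    \<open>apery_base n (Suc n) = 0\<close>.\<close>
  from this[of "Suc n"] have "(\<Sum>k\<le>Suc n. T k) = 0" by (simp only: apery_cert_def) simp
  moreover have "apery_a n = (\<Sum>k\<le>Suc n. apery_base n k ^ 2)"
    unfolding apery_a_def by (rule sum_atMost_extend[symmetric]) auto
  moreover have "apery_a (n - 1) = (\<Sum>k\<le>Suc n. apery_base (n - 1) k ^ 2)"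
    unfolding apery_a_def by (rule sum_atMost_extend[symmetric]) auto
  ultimately show ?thesis
    by (simp only: T_def sum.distrib sum_subtractf sum_distrib_left[symmetric] apery_a_def[of "Suc n"])
qed

section \<open>Apery's recurrence for the numerators\<close>

lemma apery_u_Suc_right:
  "apery_u n (Suc k) = apery_u n k + (-1) ^ k / (2 * real (Suc k) ^ 3 * apery_base n (Suc k))"
  by (simp add: apery_u_def)

text \<open>The difference collapses to one product, Apery's
  \<open>(-1)^k * k!^2 * (n - k)! / ((n + 1)^2 * (n + k + 1)!)\<close>. At \<open>k = 0\<close> it
  is the new term \<open>1 / (n + 1)^3\<close>, and each step in \<open>k\<close> preserves the
  product form.\<close>

lemma apery_u_Suc_left:
  assumes "k \<le> n"
  shows "apery_base (Suc n) k * (real n + 1 - real k) * real (Suc n) ^ 2 * (apery_u (Suc n) k - apery_u n k) = (-1) ^ k"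
  using assms
proof (induction k)
  case 0
  show ?case by (simp add: apery_u_def power2_eq_square power3_eq_cube)
next
  case (Suc k)
  define x y d e where "x = real n" and "y = real k" and "d = apery_base n k" and "e = (-1 :: real) ^ k"
  define \<delta> where "\<delta> = apery_u (Suc n) k - apery_u n k"
  have d: "d > 0" using Suc.prems by (simp add: d_def apery_base_pos)
  have y: "y + 1 > 0" by (simp add: y_def)
  have xy: "x - y > 0" "x + y + 1 > 0" "x + y + 2 > 0" using Suc.prems by (simp_all add: x_def y_def)
  have x: "x + 1 > 0" by (simp add: x_def)
  have X: "(x + 1 - y) * apery_base (Suc n) k = (x + y + 1) * d"
    using apery_base_Suc_left[of n k] by (simp add: x_def y_def d_def add_ac)
  have "((x + 1 - y) * apery_base (Suc n) k) * (x + 1) ^ 2 * \<delta> = e"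
    using Suc.IH Suc.prems by (simp add: \<delta>_def x_def y_def e_def mult_ac add_ac)
  hence "(x + y + 1) * d * (x + 1) ^ 2 * \<delta> = e" unfolding X .
  hence "\<delta> * ((x + y + 1) * d * (x + 1) ^ 2) = e" by (simp only: mult_ac)
  hence \<delta>: "\<delta> = e / ((x + y + 1) * d * (x + 1) ^ 2)"
    by (subst nonzero_eq_divide_eq) (use d xy x in simp_all)
  have "apery_u (Suc n) (Suc k) - apery_u n (Suc k) = \<delta> + e / (2 * (y + 1) ^ 3 * (d * (x + y + 1) * (x + y + 2) / (y + 1) ^ 2))
     - e / (2 * (y + 1) ^ 3 * (d * (x - y) * (x + y + 1) / (y + 1) ^ 2))"
    unfolding apery_u_Suc_right apery_base_step(1,2)[of n k] by (simp add: \<delta>_def x_def y_def d_def e_def add_ac)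
  also have "\<dots> = e / ((x + y + 1) * d) * (1 / (x + 1) ^ 2 + (1 / (2 * (y + 1) * (x + y + 2)) - 1 / (2 * (y + 1) * (x - y))))"
  proof -
    have "e / (p * d * r) + e / (2 * z ^ 3 * (d * p * w / z ^ 2)) - e / (2 * z ^ 3 * (d * v * p / z ^ 2))
      = e / (p * d) * (1 / r + (1 / (2 * z * w) - 1 / (2 * z * v)))" if "z > 0" for p r v w z :: real
      using that by (simp add: power2_eq_square power3_eq_cube distrib_left right_diff_distrib mult_ac)
    from this[OF y] show ?thesis unfolding \<delta> .
  qed
  also have "1 / (2 * (y + 1) * (x + y + 2)) - 1 / (2 * (y + 1) * (x - y)) = - 1 / ((x + y + 2) * (x - y))"
    using y xy by (simp add: divide_simps)
  \<comment> \<open>This rests on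
    \<open>(x + 1)^2 - (y + 1)^2 = (x - y) * (x + y + 2)\<close>.\<close>
  also have "1 / (x + 1) ^ 2 + - 1 / ((x + y + 2) * (x - y)) = - ((y + 1) ^ 2) / ((x + y + 2) * (x - y) * (x + 1) ^ 2)"
    using xy x by (simp add: divide_simps) algebra
  finally have "d * (x + y + 1) * (x + y + 2) / (y + 1) ^ 2 * (x - y) * (x + 1) ^ 2 *
      (apery_u (Suc n) (Suc k) - apery_u n (Suc k)) = - e"
    using d y xy x by simp
  thus ?case unfolding apery_base_step(2)[of n k] by (simp add: x_def y_def d_def e_def add_ac)
qed

text \<open>
  The certificate of the numerators is \<open>apery_cert n k * apery_u n k\<close> plus a correction that
  absorbs the terms in which \<open>apery_u\<close> is shifted.
\<close>

definition apery_b_corr :: "nat \<Rightarrow> nat \<Rightarrow> real" where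
  "apery_b_corr n k = - (5 * (2 * real n + 1) * (-1) ^ k * real k / (real n * (real n + 1)) * apery_base n k)"

definition apery_b_cert :: "nat \<Rightarrow> nat \<Rightarrow> real" where
  "apery_b_cert n k = apery_cert n k * apery_u n k + apery_b_corr n k"

text \<open>At \<open>k = 0\<close> the cubes turn the two shifts of \<open>apery_u\<close> into +1
  and -1, which cancel. Accordingly the correction, having a factor \<open>k\<close>, vanishes
  there.\<close>

lemma apery_b_cert_0:
  assumes "n > 0"
  shows "real (Suc n) ^ 3 * apery_u (Suc n) 0 - apery_poly n * apery_u n 0
      + real n ^ 3 * apery_u (n - 1) 0 = apery_b_cert n 0"
proof -
  have 1: "apery_u (Suc n) 0 = apery_u n 0 + 1 / real (Suc n) ^ 3" by (simp add: apery_u_def)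
  have "apery_u n 0 = apery_u (n - 1) 0 + 1 / real n ^ 3" using assms by (cases n) (simp_all add: apery_u_def)
  hence 2: "apery_u (n - 1) 0 = apery_u n 0 - 1 / real n ^ 3" by simp
  have "real (Suc n) ^ 3 * apery_u (Suc n) 0 - apery_poly n * apery_u n 0 + real n ^ 3 * apery_u (n - 1) 0
     = (real (Suc n) ^ 3 - apery_poly n + real n ^ 3) * apery_u n 0"
    unfolding 1 2 using assms by (simp add: distrib_left right_diff_distrib distrib_right left_diff_distrib del: of_nat_Suc)
  thus ?thesis unfolding apery_cert_0 by (simp add: apery_b_cert_def apery_b_corr_def)
qed

text \<open>The values of \<open>apery_u\<close> at \<open>n + 1\<close> and \<open>n - 1\<close>
  are compared with the value \<open>U\<close> at \<open>n\<close>. The multiple of \<open>U\<close>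
  telescopes by \<open>apery_cert_Suc\<close>; the differences are explicit by
  \<open>apery_u_Suc_left\<close> and are absorbed by \<open>apery_b_corr\<close>. That shift
  formula at \<open>k + 1\<close> requires \<open>k < n\<close>.\<close>

lemma apery_b_cert_Suc:
  assumes "k < n"
  shows "real (Suc n) ^ 3 * (apery_base (Suc n) (Suc k) ^ 2 * apery_u (Suc n) (Suc k))
      - apery_poly n * (apery_base n (Suc k) ^ 2 * apery_u n (Suc k))
      + real n ^ 3 * (apery_base (n - 1) (Suc k) ^ 2 * apery_u (n - 1) (Suc k))
    = apery_b_cert n (Suc k) - apery_b_cert n k"
proof -
  have n: "n > 0" using assms by simp
  define x y d e U where "x = real n" and "y = real k" and "d = apery_base n k" and "e = (-1 :: real) ^ k"
    and "U = apery_u n (Suc k)"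
  have d: "d > 0" using assms by (simp add: d_def apery_base_pos)
  have y: "y + 1 > 0" by (simp add: y_def)
  have xy: "x - y > 0" "x + y + 1 > 0" "x + y + 2 > 0" using assms by (simp_all add: x_def y_def)
  have x: "x > 0" "x + 1 > 0" using n by (simp_all add: x_def)
  define dp dn dm where "dp = apery_base (Suc n) (Suc k)" and "dn = apery_base n (Suc k)" and "dm = apery_base (n - 1) (Suc k)"
  have dp: "dp = d * (x + y + 1) * (x + y + 2) / (y + 1) ^ 2" and dn: "dn = d * (x - y) * (x + y + 1) / (y + 1) ^ 2"
    and dm: "dm = d * (x - y) * (x - y - 1) / (y + 1) ^ 2"
    unfolding dp_def dn_def dm_def apery_base_step(1,2)[of n k] apery_base_step(3)[OF n] by (simp_all add: x_def y_def d_def)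
  have up: "dp ^ 2 * (apery_u (Suc n) (Suc k) - U) = - e * dp / ((x - y) * (x + 1) ^ 2)"
  proof -
    have "dp * (x - y) * (x + 1) ^ 2 * (apery_u (Suc n) (Suc k) - U) = - e"
      using apery_u_Suc_left[of "Suc k" n] assms by (simp add: dp_def x_def y_def e_def U_def add_ac)
    hence "dp * (dp * (x - y) * (x + 1) ^ 2 * (apery_u (Suc n) (Suc k) - U)) = dp * - e" by (rule arg_cong)
    hence "dp ^ 2 * (apery_u (Suc n) (Suc k) - U) * ((x - y) * (x + 1) ^ 2) = - e * dp"
      by (simp only: power2_eq_square mult_ac)
    thus ?thesis by (subst nonzero_eq_divide_eq) (use xy x in simp_all)
  qed
  have um: "dm ^ 2 * (apery_u (n - 1) (Suc k) - U) = e * dm / (x ^ 2 * (x + y + 1))"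
  proof (cases "Suc k < n")
    case True
    have "dn * (x - y - 1) * x ^ 2 * (U - apery_u (n - 1) (Suc k)) = - e"
      using apery_u_Suc_left[of "Suc k" "n - 1"] True by (simp add: dn_def x_def y_def e_def U_def of_nat_diff algebra_simps)
    moreover have "dn * (x - y - 1) = dm * (x + y + 1)" unfolding dm dn by simp
    ultimately have "dm * (dm * (x + y + 1) * x ^ 2 * (U - apery_u (n - 1) (Suc k))) = dm * - e" by simp
    hence "dm ^ 2 * (apery_u (n - 1) (Suc k) - U) * (x ^ 2 * (x + y + 1)) = e * dm"
      by algebra
    thus ?thesis by (subst nonzero_eq_divide_eq) (use xy x in simp_all)
  next
    case False
    hence "dm = 0" using assms by (simp add: dm_def)
    thus ?thesis by simp
  qed
  have uk: "apery_u n k = U - e / (2 * (y + 1) ^ 3 * dn)"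
    unfolding U_def apery_u_Suc_right by (simp add: e_def y_def dn_def add_ac)
  have ck: "apery_cert n k * (e / (2 * (y + 1) ^ 3 * dn)) =
      2 * (2 * x + 1) * (y * (2 * y + 1) - (2 * x + 1) ^ 2) * d * e / ((y + 1) * (x - y) * (x + y + 1))"
  proof -
    have "4 * a * b * d ^ 2 * (e / (2 * z ^ 3 * (d * v * w / z ^ 2))) = 2 * a * b * d * e / (z * v * w)"
      if "z > 0" for a b z v w :: real
      using that d by (simp add: power2_eq_square power3_eq_cube mult_ac)
    from this[OF y] show ?thesis
      unfolding apery_cert_def dn x_def[symmetric] y_def[symmetric] d_def[symmetric] .
  qed
  have key: "(x + 1) ^ 3 * (- e * dp / ((x - y) * (x + 1) ^ 2)) + x ^ 3 * (e * dm / (x ^ 2 * (x + y + 1)))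
    = apery_cert n k * (e / (2 * (y + 1) ^ 3 * dn)) + apery_b_corr n (Suc k) - apery_b_corr n k"
  proof -
    have c1: "apery_b_corr n (Suc k) = 5 * (2 * x + 1) * e * (y + 1) / (x * (x + 1)) * dn"
      and c0: "apery_b_corr n k = - (5 * (2 * x + 1) * e * y / (x * (x + 1)) * d)"
      by (simp_all add: apery_b_corr_def x_def y_def d_def dn_def e_def add_ac)
    have l1: "(x + 1) ^ 3 * (- e * dp / ((x - y) * (x + 1) ^ 2)) = e * d * (- ((x + 1) * (x + y + 1) * (x + y + 2)) / ((x - y) * (y + 1) ^ 2))"
      unfolding dp using x xy y by (simp add: power2_eq_square power3_eq_cube mult_ac)
    have l2: "x ^ 3 * (e * dm / (x ^ 2 * (x + y + 1))) = e * d * (x * (x - y) * (x - y - 1) / ((y + 1) ^ 2 * (x + y + 1)))"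
      unfolding dm using x xy y by (simp add: power2_eq_square power3_eq_cube mult_ac)
    have r1: "apery_b_corr n (Suc k) - apery_b_corr n k = e * d * (5 * (2 * x + 1) / (x * (x + 1)) * ((x - y) * (x + y + 1) / (y + 1) + y))"
      unfolding c1 c0 dn using x y by (simp add: divide_simps power2_eq_square) (simp add: algebra_simps)
    \<comment> \<open>Since \<open>(x - y) * (x + y + 1) = x * (x + 1) - y * (y + 1)\<close>, the
      denominator \<open>n * (n + 1)\<close> of the correction cancels.\<close>
    have r1': "(x - y) * (x + y + 1) / (y + 1) + y = x * (x + 1) / (y + 1)"
      using y by (simp add: divide_simps) (simp add: algebra_simps)
    have "- ((x + 1) * (x + y + 1) * (x + y + 2)) / ((x - y) * (y + 1) ^ 2) + x * (x - y) * (x - y - 1) / ((y + 1) ^ 2 * (x + y + 1))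
      = 2 * (2 * x + 1) * (y * (2 * y + 1) - (2 * x + 1) ^ 2) / ((y + 1) * (x - y) * (x + y + 1)) + 5 * (2 * x + 1) / (y + 1)"
    proof -
      \<comment> \<open>Denominators are cleared once with opaque numerators; only a polynomial
        identity is left.\<close>
      have *: "a / (v * z ^ 2) + b / (z ^ 2 * w) = c / (z * v * w) + f / z"
        if "z > 0" "v > 0" "w > 0" "a * w + b * v = c * z + f * z * v * w" for a b c f v w z :: real
      proof -
        have "a / (v * z ^ 2) + b / (z ^ 2 * w) = (a * w + b * v) / (v * z ^ 2 * w)"
          using that(1-3) by (simp add: add_divide_distrib)
        also have "\<dots> = c / (z * v * w) + f / z"
          unfolding that(4) using that(1-3) by (simp add: add_divide_distrib power2_eq_square)
        finally show ?thesis .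
      qed
      show ?thesis by (rule *) (use y xy in simp_all, algebra)
    qed
    hence "e * d * (- ((x + 1) * (x + y + 1) * (x + y + 2)) / ((x - y) * (y + 1) ^ 2) + x * (x - y) * (x - y - 1) / ((y + 1) ^ 2 * (x + y + 1)))
      = e * d * (2 * (2 * x + 1) * (y * (2 * y + 1) - (2 * x + 1) ^ 2) / ((y + 1) * (x - y) * (x + y + 1)) + 5 * (2 * x + 1) / (y + 1))"
      by (rule arg_cong)
    also have "\<dots> = apery_cert n k * (e / (2 * (y + 1) ^ 3 * dn)) + (apery_b_corr n (Suc k) - apery_b_corr n k)"
    proof -
      have "a / p * (p / w) = a / w" if "p > 0" for a p w :: real using that by simp
      hence r2: "5 * (2 * x + 1) / (x * (x + 1)) * (x * (x + 1) / (y + 1)) = 5 * (2 * x + 1) / (y + 1)"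
        using x by simp
      show ?thesis unfolding ck r1 r1' r2 by (simp only: distrib_left times_divide_eq_right mult_ac)
    qed
    finally show ?thesis unfolding l1 l2 by (simp only: distrib_left add_diff_eq)
  qed
  have "real (Suc n) ^ 3 * (dp ^ 2 * apery_u (Suc n) (Suc k)) - apery_poly n * (dn ^ 2 * apery_u n (Suc k))
      + real n ^ 3 * (dm ^ 2 * apery_u (n - 1) (Suc k))
    = (real (Suc n) ^ 3 * dp ^ 2 - apery_poly n * dn ^ 2 + real n ^ 3 * dm ^ 2) * U +
      ((x + 1) ^ 3 * (dp ^ 2 * (apery_u (Suc n) (Suc k) - U)) + x ^ 3 * (dm ^ 2 * (apery_u (n - 1) (Suc k) - U)))"
    unfolding U_def x_def by (simp add: distrib_left right_diff_distrib distrib_right left_diff_distrib add_ac mult_ac)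
  also have "real (Suc n) ^ 3 * dp ^ 2 - apery_poly n * dn ^ 2 + real n ^ 3 * dm ^ 2 = apery_cert n (Suc k) - apery_cert n k"
    unfolding dp_def dn_def dm_def by (rule apery_cert_Suc[OF n])
  also note up
  also note um
  also note key
  also have "(apery_cert n (Suc k) - apery_cert n k) * U + (apery_cert n k * (e / (2 * (y + 1) ^ 3 * dn)) + apery_b_corr n (Suc k) - apery_b_corr n k)
    = apery_b_cert n (Suc k) - apery_b_cert n k"
    unfolding apery_b_cert_def uk U_def[symmetric] by (simp add: right_diff_distrib left_diff_distrib)
  finally show ?thesis unfolding dp_def dn_def dm_def .
qed

text \<open>
  At \<open>k = n + 1\<close> the shift formula for \<open>apery_u\<close> fails, since \<open>apery_base n (n + 1) = 0\<close> occurs there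
  as a denominator; this last summand is treated separately.
\<close>

lemma apery_b_cert_top:
  assumes "n > 0"
  shows "real (Suc n) ^ 3 * (apery_base (Suc n) (Suc n) ^ 2 * apery_u (Suc n) (Suc n)) = - apery_b_cert n n"
proof -
  define x d e where "x = real n" and "d = apery_base n n" and "e = (-1 :: real) ^ n"
  define dp where "dp = apery_base (Suc n) (Suc n)"
  have x: "x > 0" "x + 1 > 0" "2 * x + 1 > 0" using assms by (simp_all add: x_def)
  have d: "d > 0" by (simp add: d_def apery_base_pos)
  have dp: "dp = 2 * (2 * x + 1) * d / (x + 1)"
    unfolding dp_def apery_base_step(2)[of n n] x_def[symmetric] d_def[symmetric] using x
    by (simp add: divide_simps power2_eq_square) (simp add: algebra_simps)
  \<comment> \<open>In \<open>apery_cert_Suc\<close> at \<open>k = n\<close> every other term has a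
    factor \<open>apery_base n (Suc n)\<close> or \<open>apery_base (n - 1) (Suc n)\<close>, both
    0.\<close>
  have c: "(x + 1) ^ 3 * dp ^ 2 = - apery_cert n n"
    using apery_cert_Suc[OF assms, of n] by (simp add: apery_cert_def[of n "Suc n"] dp_def x_def add_ac)
  \<comment> \<open>The shift formula still holds at \<open>k = n\<close>. The last alternating term
    is then added at level \<open>n + 1\<close>, where its denominator is nonzero.\<close>
  have "(2 * x + 1) * d * (x + 1) ^ 2 * (apery_u (Suc n) n - apery_u n n) = e"
    using apery_u_Suc_left[of n n] apery_base_Suc_left[of n n] by (simp add: x_def d_def e_def add_ac)
  hence "(apery_u (Suc n) n - apery_u n n) * ((2 * x + 1) * d * (x + 1) ^ 2) = e" by (simp only: mult_ac)
  hence "apery_u (Suc n) n - apery_u n n = e / ((2 * x + 1) * d * (x + 1) ^ 2)"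
    by (subst nonzero_eq_divide_eq) (use x d in simp_all)
  hence "apery_u (Suc n) n = apery_u n n + e / ((2 * x + 1) * d * (x + 1) ^ 2)" by simp
  hence "apery_u (Suc n) (Suc n) = apery_u n n + e / ((2 * x + 1) * d * (x + 1) ^ 2) + e / (2 * (x + 1) ^ 3 * dp)"
    by (simp add: apery_u_Suc_right dp_def x_def e_def add_ac)
  hence "(x + 1) ^ 3 * (dp ^ 2 * apery_u (Suc n) (Suc n)) = (x + 1) ^ 3 * dp ^ 2 * apery_u n n +
     (x + 1) ^ 3 * dp ^ 2 * (e / ((2 * x + 1) * d * (x + 1) ^ 2) + e / (2 * (x + 1) ^ 3 * dp))"
    by (simp add: distrib_left mult_ac)
  also have "(x + 1) ^ 3 * dp ^ 2 * (e / ((2 * x + 1) * d * (x + 1) ^ 2) + e / (2 * (x + 1) ^ 3 * dp)) = - apery_b_corr n n"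
    unfolding apery_b_corr_def x_def[symmetric] d_def[symmetric] e_def[symmetric] dp using x d
    by (simp add: divide_simps power2_eq_square power3_eq_cube) (simp add: algebra_simps)
  finally show ?thesis unfolding c by (simp add: apery_b_cert_def dp_def x_def add_ac)
qed

lemma apery_b_recurrence:
  assumes "n > 0"
  shows "real (Suc n) ^ 3 * apery_b (Suc n) = apery_poly n * apery_b n - real n ^ 3 * apery_b (n - 1)"
proof -
  define T where "T k = real (Suc n) ^ 3 * (apery_base (Suc n) k ^ 2 * apery_u (Suc n) k)
      - apery_poly n * (apery_base n k ^ 2 * apery_u n k)
      + real n ^ 3 * (apery_base (n - 1) k ^ 2 * apery_u (n - 1) k)" for k
  have "m \<le> n \<Longrightarrow> (\<Sum>k\<le>m. T k) = apery_b_cert n m" for m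
    using apery_b_cert_0[OF assms] by (induction m) (simp_all add: T_def apery_b_cert_Suc del: of_nat_Suc One_nat_def)
  hence "(\<Sum>k\<le>Suc n. T k) = 0"
    using apery_b_cert_top[OF assms] by (simp add: T_def del: of_nat_Suc)
  moreover have "apery_b n = (\<Sum>k\<le>Suc n. apery_base n k ^ 2 * apery_u n k)"
    unfolding apery_b_def by (rule sum_atMost_extend[symmetric]) auto
  moreover have "apery_b (n - 1) = (\<Sum>k\<le>Suc n. apery_base (n - 1) k ^ 2 * apery_u (n - 1) k)"
    unfolding apery_b_def by (rule sum_atMost_extend[symmetric]) auto
  ultimately show ?thesis
    by (simp only: T_def sum.distrib sum_subtractf sum_distrib_left[symmetric] apery_b_def[of "Suc n"])
qed

section \<open>An auxiliary sum and the Casoratian of Apery's sequences\<close>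

lemma sum_apery_base_over_add:
  assumes "n > 0"
  shows "(\<Sum>k\<le>n. apery_base n k ^ 2 / (real n + real k)) = (7 * apery_a n + apery_a (n - 1)) / (12 * real n)"
proof -
  \<comment> \<open>The telescoping certificate: it vanishes at 0 by the factor \<open>k^4\<close>
    and at \<open>n + 1\<close> by \<open>apery_base\<close>. As \<open>k^4\<close> is the square of
    \<open>k^2\<close>, \<open>apery_base_Suc_right\<close> rewrites \<open>G (Suc k)\<close>
    without a denominator in \<open>k\<close>.\<close>
  define G where "G k = 4 * apery_base n k ^ 2 * real k ^ 4 / (real n ^ 2 * (real n + real k) ^ 2)" for k
  have step: "12 * real n * (apery_base n k ^ 2 / (real n + real k)) - 7 * apery_base n k ^ 2 - apery_base (n - 1) k ^ 2
     = G (Suc k) - G k" for k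
  proof -
    define x y t where "x = real n" and "y = real k" and "t = apery_base n k / (real n + real k)"
    have x: "x > 0" and xy: "x + y > 0" "x + y + 1 > 0" using assms by (simp_all add: x_def y_def)
    have d: "apery_base n k = t * (x + y)" and dm: "apery_base (n - 1) k = t * (x - y)"
      unfolding apery_base_prev[OF assms] using assms by (simp_all add: t_def x_def y_def)
    have "G (Suc k) = 4 * (real (Suc k) ^ 2 * apery_base n (Suc k)) ^ 2 / (x ^ 2 * (x + y + 1) ^ 2)"
      by (simp add: G_def x_def y_def power_mult_distrib add_ac mult_ac flip: power_mult)
    also have "\<dots> = 4 * (t * (x + y)) ^ 2 * (x - y) ^ 2 / x ^ 2"
      unfolding apery_base_Suc_right d x_def[symmetric] y_def[symmetric] using xy
      by (simp add: power_mult_distrib)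
    finally have g1: "G (Suc k) = 4 * (t * (x + y)) ^ 2 * (x - y) ^ 2 / x ^ 2" .
    have g0: "G k = 4 * t ^ 2 * y ^ 4 / x ^ 2"
      unfolding G_def d x_def[symmetric] y_def[symmetric] using xy by (simp add: power_mult_distrib)
    have "(12 * x * (t ^ 2 * (x + y)) - 7 * (t * (x + y)) ^ 2 - (t * (x - y)) ^ 2) * x ^ 2
       = 4 * (t * (x + y)) ^ 2 * (x - y) ^ 2 - 4 * t ^ 2 * y ^ 4" by algebra
    hence "12 * x * (t ^ 2 * (x + y)) - 7 * (t * (x + y)) ^ 2 - (t * (x - y)) ^ 2
       = (4 * (t * (x + y)) ^ 2 * (x - y) ^ 2 - 4 * t ^ 2 * y ^ 4) / x ^ 2"
      by (subst nonzero_eq_divide_eq) (use x in simp_all)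
    moreover have "(t * (x + y)) ^ 2 / (x + y) = t ^ 2 * (x + y)"
      using xy by (simp add: power2_eq_square)
    ultimately show ?thesis
      unfolding g0 g1 d dm x_def[symmetric] y_def[symmetric] by (simp only: diff_divide_distrib)
  qed
  have "(\<Sum>k\<le>n. 12 * real n * (apery_base n k ^ 2 / (real n + real k)) - 7 * apery_base n k ^ 2 - apery_base (n - 1) k ^ 2)
     = G (Suc n) - G 0"
    unfolding step using sum_telescope[of "\<lambda>k. - G k" n] by simp
  also have "\<dots> = 0" by (simp add: G_def)
  also have "(\<Sum>k\<le>n. 12 * real n * (apery_base n k ^ 2 / (real n + real k)) - 7 * apery_base n k ^ 2 - apery_base (n - 1) k ^ 2)
    = 12 * real n * (\<Sum>k\<le>n. apery_base n k ^ 2 / (real n + real k)) - 7 * apery_a n - (\<Sum>k\<le>n. apery_base (n - 1) k ^ 2)"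
    by (simp add: sum_subtractf sum_distrib_left apery_a_def)
  also have "(\<Sum>k\<le>n. apery_base (n - 1) k ^ 2) = apery_a (n - 1)"
    unfolding apery_a_def by (rule sum_atMost_extend) (use assms in auto)
  finally show ?thesis using assms by (simp add: field_simps)
qed

text \<open>The outer coefficients of the recurrence are consecutive cubes, so
  \<open>(n + 1)^3\<close> times the Casoratian is constant. Its value 6 comes from
  \<open>a = 1, 5\<close> and \<open>b = 0, 6\<close> at \<open>n = 0, 1\<close>.\<close>

lemma apery_casoratian:
  "apery_a n * apery_b (Suc n) - apery_a (Suc n) * apery_b n = 6 / real (Suc n) ^ 3"
proof (induction n)
  case 0
  show ?case by (simp add: apery_a_def apery_b_def apery_u_def apery_base_def)
next
  case (Suc n)
  define p where "p = apery_poly (Suc n)"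
  have ra: "real (Suc (Suc n)) ^ 3 * apery_a (Suc (Suc n)) = p * apery_a (Suc n) - real (Suc n) ^ 3 * apery_a n"
   and rb: "real (Suc (Suc n)) ^ 3 * apery_b (Suc (Suc n)) = p * apery_b (Suc n) - real (Suc n) ^ 3 * apery_b n"
    using apery_a_recurrence[of "Suc n"] apery_b_recurrence[of "Suc n"] by (simp_all add: p_def)
  have "real (Suc (Suc n)) ^ 3 * (apery_a (Suc n) * apery_b (Suc (Suc n)) - apery_a (Suc (Suc n)) * apery_b (Suc n))
     = apery_a (Suc n) * (real (Suc (Suc n)) ^ 3 * apery_b (Suc (Suc n))) -
       (real (Suc (Suc n)) ^ 3 * apery_a (Suc (Suc n))) * apery_b (Suc n)" by (simp only: algebra_simps)
  also have "\<dots> = real (Suc n) ^ 3 * (apery_a n * apery_b (Suc n) - apery_a (Suc n) * apery_b n)"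
    unfolding ra rb by (simp only: algebra_simps)
  also have "\<dots> = 6" unfolding Suc by simp
  finally show ?case by (simp add: field_simps)
qed

section \<open>Theta as a combination of Apery numbers\<close>

lemma Theta_eq_sum:
  assumes "n > 0"
  shows "Theta \<rho> n = (\<Sum>k\<le>n. apery_base n k ^ 2 * ((real \<rho> * real n + 1 + real k) / (real n + real k)))"
proof -
  define c where "c = real \<rho> * real n + 1"
  have c: "c > 0" by (simp add: c_def add_nonneg_pos)
  define f where "f k = prod_list (map (\<lambda>a. pochhammer a k) [real n + 1, real n, - real n, - real n, real \<rho> * real n + 2])
     / prod_list (map (\<lambda>b. pochhammer b k) [1, 1, 1, real \<rho> * real n + 1]) * (1 ^ k / fact k)" for k
  have neg: "pochhammer (- real n) k = (-1) ^ k * fact k * real (n choose k)" for k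
  proof -
    have "real (n choose k) = (-1) ^ k * pochhammer (- real n) k / fact k"
      unfolding binomial_gbinomial by (rule gbinomial_pochhammer)
    thus ?thesis by (simp add: mult.assoc[symmetric] flip: power_mult_distrib)
  qed
  have pos: "pochhammer (real n + 1) k = fact k * real ((n + k) choose k)" for k
  proof -
    have "real ((n + k) choose k) = pochhammer (real (n + k) - real k + 1) k / fact k"
      unfolding binomial_gbinomial by (rule gbinomial_pochhammer')
    thus ?thesis by simp
  qed
  \<comment> \<open>Parameters differing by 1 contribute only linear factors: \<open>n\<close>
    against \<open>n + 1\<close> here, \<open>c + 1\<close> against \<open>c\<close> next. The
    leftover constants \<open>n\<close> and \<open>1 / c\<close> cancel the prefactor
    \<open>c / n\<close>.\<close>
  have pos': "pochhammer (real n) k = real n * pochhammer (real n + 1) k / (real n + real k)" for k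
    using pochhammer_rec[of "real n" k] pochhammer_Suc[of "real n" k] assms by (simp add: field_simps)
  have shift: "pochhammer (real \<rho> * real n + 2) k = pochhammer c k * (c + real k) / c" for k
    using pochhammer_rec[of c k] pochhammer_Suc[of c k] c by (simp add: field_simps c_def)
  have cp: "pochhammer c k > 0" for k using c by (rule pochhammer_pos)
  have f: "c / real n * f k = apery_base n k ^ 2 * ((c + real k) / (real n + real k))" for k
  proof -
    have sq: "(-1 :: real) ^ k * (-1) ^ k = 1" by (simp flip: power_mult_distrib)
    have "f k = pochhammer (real n + 1) k * pochhammer (real n) k * (pochhammer (- real n) k * pochhammer (- real n) k) *
       pochhammer (real \<rho> * real n + 2) k / (fact k ^ 3 * pochhammer c k) / fact k"
      by (simp add: f_def c_def pochhammer_fact[symmetric] power3_eq_cube mult_ac)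
    also have "pochhammer (- real n) k * pochhammer (- real n) k = ((-1) ^ k * (-1) ^ k) * (fact k * real (n choose k)) ^ 2"
      unfolding neg by (simp only: power2_eq_square mult_ac)
    finally have fk: "f k = pochhammer (real n + 1) k * pochhammer (real n) k * ((-1) ^ k * (-1) ^ k * (fact k * real (n choose k)) ^ 2) *
       pochhammer (real \<rho> * real n + 2) k / (fact k ^ 3 * pochhammer c k) / fact k" .
    have g: "c / real n * (F * N * (real n * (F * N) / m) * (1 * (F * B) ^ 2) * (p * t / c) / (F ^ 3 * p) / F)
       = (B * N) ^ 2 * (t / m)" if "F > 0" "p > 0" for F N B p t m :: real
      using that assms c by (simp add: power2_eq_square power3_eq_cube mult_ac)
    show ?thesis unfolding fk sq pos' pos shift apery_base_def of_nat_mult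
      by (rule g) (use cp in simp_all)
  qed
  have "f k = 0" if "k \<notin> {..n}" for k using that by (simp add: f_def neg)
  hence "(\<Sum>k. f k) = (\<Sum>k\<le>n. f k)" by (intro suminf_finite) auto
  hence "Theta \<rho> n = c / real n * (\<Sum>k\<le>n. f k)"
    by (simp only: Theta_def hypergeom_def f_def c_def)
  thus ?thesis unfolding sum_distrib_left f by (simp add: c_def)
qed

text \<open>Arises from the splitting
  \<open>\<rho> * n + 1 + k = (n + k) + ((\<rho> - 1) * n + 1)\<close>: the first part yields
  \<open>apery_a n\<close>, the second meets \<open>sum_apery_base_over_add\<close>.\<close>

definition Theta_weight :: "nat \<Rightarrow> nat \<Rightarrow> real" where
  "Theta_weight \<rho> n = ((real \<rho> - 1) * real n + 1) / (12 * real n)"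

lemma Theta_eq_apery:
  assumes "n > 0"
  shows "Theta \<rho> n = (1 + 7 * Theta_weight \<rho> n) * apery_a n + Theta_weight \<rho> n * apery_a (n - 1)"
proof -
  have "Theta \<rho> n = (\<Sum>k\<le>n. apery_base n k ^ 2 + ((real \<rho> - 1) * real n + 1) * (apery_base n k ^ 2 / (real n + real k)))"
    unfolding Theta_eq_sum[OF assms] using assms by (intro sum.cong) (auto simp: field_simps)
  also have "\<dots> = apery_a n + ((real \<rho> - 1) * real n + 1) * ((7 * apery_a n + apery_a (n - 1)) / (12 * real n))"
    by (simp only: sum.distrib sum_distrib_left[symmetric] sum_apery_base_over_add[OF assms] apery_a_def[of n])
  also have "((real \<rho> - 1) * real n + 1) * ((7 * apery_a n + apery_a (n - 1)) / (12 * real n))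
     = Theta_weight \<rho> n * (7 * apery_a n + apery_a (n - 1))" by (simp add: Theta_weight_def)
  finally show ?thesis by (simp add: algebra_simps)
qed

section \<open>The Casoratian of Theta and its numerators\<close>

definition Theta_num :: "nat \<Rightarrow> nat \<Rightarrow> real" where
  "Theta_num \<rho> n = (1 + 7 * Theta_weight \<rho> n) * apery_b n + Theta_weight \<rho> n * apery_b (n - 1)"

text \<open>By bilinearity the left side is a combination of the three 2x2 minors of
  \<open>apery_a\<close> and \<open>apery_b\<close> at \<open>n - 1\<close>, \<open>n\<close>,
  \<open>n + 1\<close>. Two are consecutive Casoratians; the recurrence reduces the third to one of
  these.\<close>

lemma Theta_casoratian:
  assumes "n > 0"
  shows "Theta \<rho> n * Theta_num \<rho> (Suc n) - Theta \<rho> (Suc n) * Theta_num \<rho> n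
    = Phi \<rho> n / (2 * real n ^ 4 * (real n + 1) ^ 4)"
proof -
  define p q p' q' where "p = 1 + 7 * Theta_weight \<rho> n" and "q = Theta_weight \<rho> n"
    and "p' = 1 + 7 * Theta_weight \<rho> (Suc n)" and "q' = Theta_weight \<rho> (Suc n)"
  define a0 a1 a2 b0 b1 b2 where "a0 = apery_a (n - 1)" and "a1 = apery_a n" and "a2 = apery_a (Suc n)"
    and "b0 = apery_b (n - 1)" and "b1 = apery_b n" and "b2 = apery_b (Suc n)"
  define x where "x = real n"
  have x: "x > 0" using assms by (simp add: x_def)
  have w1: "a0 * b1 - a1 * b0 = 6 / x ^ 3"
    using apery_casoratian[of "n - 1"] assms by (simp add: a0_def a1_def b0_def b1_def x_def)
  have w2: "a1 * b2 - a2 * b1 = 6 / (x + 1) ^ 3"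
    using apery_casoratian[of n] by (simp add: a1_def a2_def b1_def b2_def x_def add.commute)
  have ra: "a2 = (apery_poly x * a1 - x ^ 3 * a0) / (x + 1) ^ 3"
   and rb: "b2 = (apery_poly x * b1 - x ^ 3 * b0) / (x + 1) ^ 3"
    using apery_a_recurrence[OF assms] apery_b_recurrence[OF assms] x
    by (simp_all add: a0_def a1_def a2_def b0_def b1_def b2_def x_def field_simps)
  \<comment> \<open>The contributions \<open>x^3 * a0 * b0\<close> cancel.\<close>
  have "a0 * b2 - a2 * b0 = apery_poly x * (a0 * b1 - a1 * b0) / (x + 1) ^ 3"
    unfolding ra rb using x by (simp add: field_simps)
  hence w3: "a0 * b2 - a2 * b0 = apery_poly x * (6 / x ^ 3) / (x + 1) ^ 3" unfolding w1 .
  have "Theta \<rho> n * Theta_num \<rho> (Suc n) - Theta \<rho> (Suc n) * Theta_num \<rho> n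
    = (p * a1 + q * a0) * (p' * b2 + q' * b1) - (p' * a2 + q' * a1) * (p * b1 + q * b0)"
    by (simp add: Theta_eq_apery assms Theta_num_def p_def q_def p'_def q'_def a0_def a1_def a2_def b0_def b1_def b2_def)
  also have "\<dots> = p * p' * (a1 * b2 - a2 * b1) + q * p' * (a0 * b2 - a2 * b0) + q * q' * (a0 * b1 - a1 * b0)"
    by (simp add: algebra_simps)
  also have "\<dots> = p * p' * (6 / (x + 1) ^ 3) + q * p' * (apery_poly x * (6 / x ^ 3) / (x + 1) ^ 3) + q * q' * (6 / x ^ 3)"
    unfolding w1 w2 w3 ..
  also have "\<dots> = Phi \<rho> n / (2 * x ^ 4 * (x + 1) ^ 4)"
  proof -
    define r where "r = real \<rho>"
    define y where "y = x + 1"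
    have y: "y > 0" using x by (simp add: y_def)
    have q: "q = ((r - 1) * x + 1) / (12 * x)" and q': "q' = ((r - 1) * y + 1) / (12 * y)"
      by (simp_all add: q_def q'_def Theta_weight_def r_def x_def y_def add.commute)
    have p: "p = (12 * x + 7 * ((r - 1) * x + 1)) / (12 * x)" and p': "p' = (12 * y + 7 * ((r - 1) * y + 1)) / (12 * y)"
      using x y q q' by (simp_all add: p_def p'_def q_def q'_def field_simps)
    have ph: "Phi \<rho> n = 24 * x^5 * r^2 - 12 * x^5 + 54 * x^4 * r^2 + 39 * x^4 * r - 33 * x^4
     + 46 * x^3 * r^2 + 70 * x^3 * r + 19 * x^2 * r^2 + 56 * x^2 * r + 33 * x^2
     + 3 * x * r^2 + 21 * x * r + 24 * x + 3 * r + 5"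
      by (simp add: Phi_def Let_def r_def x_def)
    have g: "(A / (12 * x) * (B / (12 * y)) * (6 / y ^ 3) + C / (12 * x) * (B / (12 * y)) * (P * (6 / x ^ 3) / y ^ 3)
         + C / (12 * x) * (D / (12 * y)) * (6 / x ^ 3)) * (2 * x ^ 4 * y ^ 4)
       = (A * B * x ^ 3 + C * B * P + C * D * y ^ 3) / 12" for A B C D P
      using x y by (simp add: distrib_right power3_eq_cube power4_eq_xxxx add_divide_distrib) (simp add: mult_ac)
    have "(p * p' * (6 / y ^ 3) + q * p' * (apery_poly x * (6 / x ^ 3) / y ^ 3) + q * q' * (6 / x ^ 3)) * (2 * x ^ 4 * y ^ 4)
       = ((12 * x + 7 * ((r - 1) * x + 1)) * (12 * y + 7 * ((r - 1) * y + 1)) * x ^ 3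
         + ((r - 1) * x + 1) * (12 * y + 7 * ((r - 1) * y + 1)) * apery_poly x
         + ((r - 1) * x + 1) * ((r - 1) * y + 1) * y ^ 3) / 12"
      unfolding p p' q q' by (rule g)
    also have "\<dots> = Phi \<rho> n"
    proof -
      \<comment> \<open>The explicit coefficients of \<open>Phi\<close> are verified here.\<close>
      have "(12 * x + 7 * ((r - 1) * x + 1)) * (12 * y + 7 * ((r - 1) * y + 1)) * x ^ 3
         + ((r - 1) * x + 1) * (12 * y + 7 * ((r - 1) * y + 1)) * apery_poly x
         + ((r - 1) * x + 1) * ((r - 1) * y + 1) * y ^ 3 = Phi \<rho> n * 12"
        unfolding ph y_def apery_poly_def by algebra
      thus ?thesis by simp
    qed
    finally show ?thesis using x y unfolding y_def[symmetric] by (subst nonzero_eq_divide_eq) simp_all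
  qed
  finally show ?thesis by (simp add: x_def)
qed

section \<open>Convergence to zeta(3)\<close>

lemma zeta3_summable: "summable (\<lambda>m. 1 / real (Suc m) ^ 3)"
  using inverse_power_summable[of 3, where ?'a = real] summable_Suc_iff[of "\<lambda>n. inverse (real n ^ 3)"]
  by (simp add: inverse_eq_divide)

definition apery_err :: "nat \<Rightarrow> real" where
  "apery_err n = \<bar>(\<Sum>m<n. 1 / real (Suc m) ^ 3) - zeta3\<bar> + zeta3 / real (Suc n)"

lemma apery_err_tendsto_0: "apery_err \<longlonglongrightarrow> 0"
proof -
  have "(\<lambda>n. \<Sum>m<n. 1 / real (Suc m) ^ 3) \<longlonglongrightarrow> zeta3"
    unfolding zeta3_def using zeta3_summable by (rule summable_LIMSEQ)
  hence "(\<lambda>n. \<bar>(\<Sum>m<n. 1 / real (Suc m) ^ 3) - zeta3\<bar> + zeta3 * inverse (real (Suc n))) \<longlonglongrightarrow> \<bar>zeta3 - zeta3\<bar> + zeta3 * 0"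
    by (intro tendsto_intros LIMSEQ_inverse_real_of_nat)
  thus ?thesis by (simp add: apery_err_def[abs_def] divide_inverse)
qed

text \<open>For \<open>1 \<le> m \<le> n\<close> one has \<open>apery_base n m \<ge> n + 1\<close>,
  so the alternating part is at most \<open>zeta3 / (n + 1)\<close>. The bound is uniform in
  \<open>k\<close> and hence survives averaging over \<open>k\<close>.\<close>

lemma apery_u_approx:
  assumes "k \<le> n"
  shows "\<bar>apery_u n k - zeta3\<bar> \<le> apery_err n"
proof -
  have "\<bar>\<Sum>m<k. (-1) ^ m / (2 * real (Suc m) ^ 3 * apery_base n (Suc m))\<bar> \<le> (\<Sum>m<k. 1 / real (Suc m) ^ 3 / real (Suc n))"
  proof (rule order_trans[OF sum_abs], rule sum_mono)
    fix m assume "m \<in> {..<k}"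
    hence m: "Suc m \<le> n" using assms by auto
    have "1 \<le> n choose Suc m" using m by (simp add: Suc_leI)
    moreover have "Suc n \<le> (n + Suc m) choose Suc m"
    proof -
      have "Suc n choose n \<le> (n + Suc m) choose n" by (rule binomial_right_mono) simp
      thus ?thesis using binomial_symmetric[of n "n + Suc m"] by simp
    qed
    ultimately have "1 * Suc n \<le> (n choose Suc m) * ((n + Suc m) choose Suc m)" by (rule mult_le_mono)
    hence "real (Suc n) \<le> apery_base n (Suc m)" unfolding apery_base_def by (simp only: of_nat_le_iff) simp
    hence "real (Suc m) ^ 3 * real (Suc n) \<le> 2 * real (Suc m) ^ 3 * apery_base n (Suc m)"
      by (intro mult_mono) auto
    hence "1 / (2 * real (Suc m) ^ 3 * apery_base n (Suc m)) \<le> 1 / (real (Suc m) ^ 3 * real (Suc n))"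
      by (intro divide_left_mono mult_pos_pos) (use apery_base_pos[OF m] in auto)
    thus "\<bar>(-1) ^ m / (2 * real (Suc m) ^ 3 * apery_base n (Suc m))\<bar> \<le> 1 / real (Suc m) ^ 3 / real (Suc n)"
      using apery_base_pos[OF m] by (simp add: abs_mult power_abs)
  qed
  also have "\<dots> = (\<Sum>m<k. 1 / real (Suc m) ^ 3) / real (Suc n)" by (simp only: sum_divide_distrib)
  also have "\<dots> \<le> zeta3 / real (Suc n)"
    unfolding zeta3_def by (intro divide_right_mono sum_le_suminf zeta3_summable) auto
  finally show ?thesis unfolding apery_u_def apery_err_def by linarith
qed

text \<open>\<open>apery_b n / apery_a n\<close> is a mean of the \<open>apery_u n k\<close> with
  weights \<open>apery_base n k ^ 2\<close>.\<close>

lemma apery_b_approx: "\<bar>apery_b n - zeta3 * apery_a n\<bar> \<le> apery_err n * apery_a n"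
proof -
  have "apery_b n - zeta3 * apery_a n = (\<Sum>k\<le>n. apery_base n k ^ 2 * (apery_u n k - zeta3))"
    by (simp add: apery_b_def apery_a_def sum_distrib_left sum_subtractf algebra_simps)
  also have "\<bar>\<dots>\<bar> \<le> (\<Sum>k\<le>n. apery_base n k ^ 2 * apery_err n)"
    by (rule order_trans[OF sum_abs], rule sum_mono) (auto simp: abs_mult intro!: mult_left_mono apery_u_approx)
  also have "\<dots> = apery_err n * apery_a n" by (simp add: apery_a_def sum_distrib_left mult.commute)
  finally show ?thesis .
qed

lemma apery_a_pos: "apery_a n > 0"
  unfolding apery_a_def by (intro sum_pos) (auto simp: apery_base_pos less_imp_neq[symmetric])

lemma Theta_pos:
  assumes "\<rho> > 0" "n > 0"
  shows "Theta \<rho> n > 0"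
proof -
  have "real \<rho> * real n + 1 + real k > 0" for k
    using mult_nonneg_nonneg[of "real \<rho>" "real n"] by linarith
  thus ?thesis unfolding Theta_eq_sum[OF assms(2)] using assms
    by (intro sum_pos mult_pos_pos divide_pos_pos zero_less_power apery_base_pos) auto
qed

lemma Theta_num_approx:
  assumes "\<rho> > 0" "n > 0"
  shows "\<bar>Theta_num \<rho> n / Theta \<rho> n - zeta3\<bar> \<le> apery_err n + apery_err (n - 1)"
proof -
  define p q where "p = 1 + 7 * Theta_weight \<rho> n" and "q = Theta_weight \<rho> n"
  \<comment> \<open>Positivity of \<open>\<rho>\<close> makes both weights nonnegative.\<close>
  have "Theta_weight \<rho> n \<ge> 0" using assms by (simp add: Theta_weight_def)
  hence pq: "p \<ge> 0" "q \<ge> 0" by (simp_all add: p_def q_def)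
  have e: "apery_err m \<ge> 0" for m
    using order_trans[OF abs_ge_zero apery_u_approx[of 0 m]] by simp
  have T: "Theta \<rho> n = p * apery_a n + q * apery_a (n - 1)"
    using Theta_eq_apery[OF assms(2)] by (simp add: p_def q_def)
  have "\<bar>Theta_num \<rho> n - zeta3 * Theta \<rho> n\<bar> =
     \<bar>p * (apery_b n - zeta3 * apery_a n) + q * (apery_b (n - 1) - zeta3 * apery_a (n - 1))\<bar>"
    unfolding T Theta_num_def p_def q_def by (simp add: algebra_simps)
  also have "\<dots> \<le> p * \<bar>apery_b n - zeta3 * apery_a n\<bar> + q * \<bar>apery_b (n - 1) - zeta3 * apery_a (n - 1)\<bar>"
    using pq by (metis abs_triangle_ineq abs_mult abs_of_nonneg)
  also have "\<dots> \<le> p * (apery_err n * apery_a n) + q * (apery_err (n - 1) * apery_a (n - 1))"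
    by (intro add_mono mult_left_mono apery_b_approx pq)
  \<comment> \<open>The right side exceeds the left by nonnegative cross terms.\<close>
  also have "\<dots> \<le> (apery_err n + apery_err (n - 1)) * Theta \<rho> n"
    unfolding T using e pq apery_a_pos[of n] apery_a_pos[of "n - 1"] by (simp add: algebra_simps)
  finally have "\<bar>Theta_num \<rho> n - zeta3 * Theta \<rho> n\<bar> / Theta \<rho> n \<le> apery_err n + apery_err (n - 1)"
    using Theta_pos[OF assms] by (simp add: divide_le_eq)
  moreover have "Theta_num \<rho> n / Theta \<rho> n - zeta3 = (Theta_num \<rho> n - zeta3 * Theta \<rho> n) / Theta \<rho> n"
    using Theta_pos[OF assms] by (simp add: field_simps)
  ultimately show ?thesis using Theta_pos[OF assms] by (simp add: abs_divide)
qed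

section \<open>Telescoping the series\<close>

theorem theorem4:
  fixes \<rho> :: nat
  assumes "\<rho> > 0"
  shows "summable (\<lambda>n. zeta3_term \<rho> (Suc n)) \<and>
         zeta3 = (7 * real \<rho> + 12) / (6 * real \<rho> + 10) + (\<Sum>n. zeta3_term \<rho> (Suc n))"
proof -
  \<comment> \<open>The shift by one makes the sequence start at \<open>Theta \<rho> 1\<close>, as
    \<open>Theta\<close> divides by its index.\<close>
  define w where "w n = Theta_num \<rho> (Suc n) / Theta \<rho> (Suc n)" for n
  have "(\<lambda>n. w n - zeta3) \<longlonglongrightarrow> 0"
  proof (rule Lim_null_comparison)
    show "\<forall>\<^sub>F n in sequentially. norm (w n - zeta3) \<le> apery_err (Suc n) + apery_err n"
      using Theta_num_approx[OF assms, of "Suc _"] by (simp add: w_def)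
    show "(\<lambda>n. apery_err (Suc n) + apery_err n) \<longlonglongrightarrow> 0"
      using tendsto_add[OF LIMSEQ_Suc[OF apery_err_tendsto_0] apery_err_tendsto_0] by simp
  qed
  hence "w \<longlonglongrightarrow> zeta3" by (simp add: LIM_zero_iff)
  hence "(\<lambda>n. w (Suc n) - w n) sums (zeta3 - w 0)" by (rule telescope_sums)
  moreover have "w (Suc n) - w n = zeta3_term \<rho> (Suc n)" for n
  proof -
    have T: "Theta \<rho> (Suc n) > 0" "Theta \<rho> (Suc (Suc n)) > 0" using Theta_pos[OF assms] by simp_all
    have "w (Suc n) - w n = (Theta \<rho> (Suc n) * Theta_num \<rho> (Suc (Suc n)) - Theta \<rho> (Suc (Suc n)) * Theta_num \<rho> (Suc n))
       / (Theta \<rho> (Suc n) * Theta \<rho> (Suc (Suc n)))"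
      using T by (simp add: w_def field_simps)
    thus ?thesis using Theta_casoratian[of "Suc n" \<rho>] by (simp add: zeta3_term_def mult_ac)
  qed
  \<comment> \<open>At index 1 the weight is \<open>\<rho> / 12\<close>, so \<open>w 0\<close> is
    \<open>6 * (12 + 7 * \<rho>) / (60 + 36 * \<rho>)\<close>.\<close>
  moreover have "w 0 = (7 * real \<rho> + 12) / (6 * real \<rho> + 10)"
    using Theta_eq_apery[of 1 \<rho>]
    by (simp add: w_def Theta_num_def Theta_weight_def apery_a_def apery_b_def apery_u_def apery_base_def field_simps)
  ultimately show ?thesis by (auto simp: sums_iff)
qed

end
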